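(* The collection $\{1324, 231\}$ is inversion monotone; that is, for all integers $n, k \ge 0$, the number of permutations of length $n$ with exactly $k$ inversions that avoid both $1324$ and $231$ is at most the number of permutations of length $n+1$ with exactly $k$ inversions that avoid both $1324$ and $231$.
   Context: A permutation $\pi\in S_n$ contains a pattern $p \in S_m$ if $\pi$ (in one-line notation) has a subsequence order-isomorphic to $p$; otherwise $\pi$ avoids $p$. An inversion of $\pi$ is a pair $i<j$ with $\pi_i>\pi_j$. For a set $B$ of patterns, $\mathrm{av}_n^k(B)$ is the number of permutations in $S_n$ with exactly $k$ inversions that avoid every pattern in $B$. $B$ is called inversion monotone if $\mathrm{av}_n^k(B)\le \mathrm{av}_{n+1}^k(B)$ for all $n$ and $k$. *)

theory Defs
  imports "HOL-Combinatorics.Multiset_Permutations" "HOL-Library.Sublist"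
begin

text \<open>
  A permutation of length n is given by its one-line notation, i.e. as an element of
  \<^term>\<open>permutations_of_set {1..n}\<close>. For n = 0 the only permutation is the empty list.
  Positions in a list count from 0, values from 1.
\<close>

definition order_isomorphic :: "nat list \<Rightarrow> nat list \<Rightarrow> bool" where
  "order_isomorphic xs ys \<longleftrightarrow>
     length xs = length ys \<and>
     (\<forall>i < length xs. \<forall>j < length xs. xs ! i < xs ! j \<longleftrightarrow> ys ! i < ys ! j)"

definition contains_pattern :: "nat list \<Rightarrow> nat list \<Rightarrow> bool" where
  "contains_pattern \<pi> p \<longleftrightarrow> (\<exists>s. subseq s \<pi> \<and> order_isomorphic s p)"

definition inversions :: "nat list \<Rightarrow> (nat \<times> nat) set" where
  "inversions \<pi> = {(i, j). i < j \<and> j < length \<pi> \<and> \<pi> ! i > \<pi> ! j}"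

definition av :: "nat \<Rightarrow> nat \<Rightarrow> nat list set \<Rightarrow> nat" where
  "av n k B =
     card {\<pi> \<in> permutations_of_set {1..n}.
             card (inversions \<pi>) = k \<and> (\<forall>p \<in> B. \<not> contains_pattern \<pi> p)}"

definition inversion_monotone :: "nat list set \<Rightarrow> bool" where
  "inversion_monotone B \<longleftrightarrow> (\<forall>n k. av n k B \<le> av (n + 1) k B)"

end

(*
  A 231-avoiding permutation is sigma n tau with every entry of sigma below every entry of tau.
  It also avoids 1324 iff either sigma is empty and tau avoids 1324, or sigma is nonempty and avoids
  132 while tau avoids 213.  The {132,231}-avoiders and the {213,231}-avoiders of length m both have
  inversion polynomial D m = prod_{0<i<m} (1 + X^i) (dist_poly), so the inversion polynomials F n of
  the {1324,231}-avoiders (av_poly) satisfy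
    F (n+1) = X^n F n + T n,   T n = sum_{b<n} X^b D (n-b) D b   (split_poly).
  Since T (n+1) = T n + X^n C n with C n = sum_{b<=n} D (n-b) D b (conv_poly), the coefficientwise
  inequality F n <= F (n+1) reduces to F m <= C m + X F (m+1) for m = n - 1.  Here
  F m = T (m-1) + X^(m-1) F (m-1); for m >= 2 the first summand is at most C m, and the second is at
  most X F (m+1) because X^j F l <= F (l+2) for all j <= l.  Everything rests on X^j D m <= D (m+1)
  for j <= m.
*)
theory Submission
  imports Defs "HOL-Computational_Algebra.Polynomial"
begin

section \<open>Coefficientwise comparison of inversion polynomials\<close>

text \<open>Over the naturals a complement \<open>s\<close> exists exactly when every coefficient of
  \<open>p\<close> is at most that of \<open>r\<close>. The additive form reduces compatibility with
  sums and products to ring identities.\<close>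

definition coeff_le :: "nat poly \<Rightarrow> nat poly \<Rightarrow> bool" (infix "\<preceq>" 50) where
  "p \<preceq> r \<longleftrightarrow> (\<exists>s. r = p + s)"

lemma coeff_le_refl [simp]: "p \<preceq> p"
  by (auto simp: coeff_le_def intro: exI[of _ 0])

lemma coeff_le_add_right [simp]: "p \<preceq> p + s"
  by (auto simp: coeff_le_def)

lemma coeff_le_add_left [simp]: "p \<preceq> s + p"
  by (auto simp: coeff_le_def add.commute)

lemma coeff_le_trans [trans]: "p \<preceq> r \<Longrightarrow> r \<preceq> s \<Longrightarrow> p \<preceq> s"
  by (auto simp: coeff_le_def add.assoc)

lemma coeff_le_add_mono: "p \<preceq> r \<Longrightarrow> p' \<preceq> r' \<Longrightarrow> p + p' \<preceq> r + r'"
  unfolding coeff_le_def by (metis add.assoc add.commute)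

lemma coeff_le_mult_left: "p \<preceq> r \<Longrightarrow> s * p \<preceq> s * r"
  by (auto simp: coeff_le_def distrib_left)

lemma coeff_le_mult_mono: "p \<preceq> r \<Longrightarrow> p' \<preceq> r' \<Longrightarrow> p * p' \<preceq> r * r'"
  by (metis coeff_le_mult_left coeff_le_trans mult.commute)

lemma coeff_le_sum_mono: "(\<And>x. x \<in> A \<Longrightarrow> f x \<preceq> g x) \<Longrightarrow> sum f A \<preceq> sum g A"
  by (induction A rule: infinite_finite_induct) (simp_all add: coeff_le_add_mono)

text \<open>Terms are compared along the injection \<open>h\<close>; the terms of \<open>g\<close>
  outside its image only add to the right side. It serves for index shifts, with
  \<open>h = Suc\<close>.\<close>

lemma coeff_le_sum_reindex:
  assumes "finite B" "inj_on h A" "h ` A \<subseteq> B" "\<And>x. x \<in> A \<Longrightarrow> f x \<preceq> g (h x)"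
  shows "sum f A \<preceq> sum g B"
proof -
  have "sum f A \<preceq> sum g (h ` A)"
    using assms by (simp add: sum.reindex coeff_le_sum_mono)
  also have "\<dots> \<preceq> sum g B"
    using assms by (subst sum.subset_diff[of "h ` A" B]) auto
  finally show ?thesis .
qed

lemma coeff_leD: "p \<preceq> r \<Longrightarrow> coeff p k \<le> coeff r k"
  by (auto simp: coeff_le_def)

section \<open>The polynomials of the three classes and their recurrences\<close>

definition X :: "nat poly" where "X = [:0, 1:]"

text \<open>This is the generating function of partitions into distinct parts smaller than
  \<open>m\<close>. The product starts at 1, so both \<open>m = 0\<close> and \<open>m = 1\<close>
  give the empty product.\<close>

definition dist_poly :: "nat \<Rightarrow> nat poly" where "dist_poly m = (\<Prod>i = 1..<m. 1 + X ^ i)"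

text \<open>The index \<open>b\<close> is the number of entries after the maximum, each forming an
  inversion with it; \<open>b < n\<close> leaves at least one entry before it.\<close>

definition split_poly :: "nat \<Rightarrow> nat poly" where "split_poly n = (\<Sum>b<n. X ^ b * dist_poly (n - b) * dist_poly b)"

definition conv_poly :: "nat \<Rightarrow> nat poly" where "conv_poly n = (\<Sum>b\<le>n. dist_poly (n - b) * dist_poly b)"

fun av_poly :: "nat \<Rightarrow> nat poly" where
  "av_poly 0 = 1"
| "av_poly (Suc n) = X ^ n * av_poly n + split_poly n"

lemma dist_poly_0 [simp]: "dist_poly 0 = 1" and dist_poly_1 [simp]: "dist_poly (Suc 0) = 1"
  by (simp_all add: dist_poly_def)

lemma dist_poly_Suc: "m > 0 \<Longrightarrow> dist_poly (Suc m) = dist_poly m + X ^ m * dist_poly m"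
  by (cases m) (simp_all add: dist_poly_def algebra_simps)

lemma dist_poly_le_dist_poly_Suc: "dist_poly m \<preceq> dist_poly (Suc m)"
  by (cases "m = 0") (simp_all add: dist_poly_Suc)

text \<open>Induction on \<open>m\<close>: both sides are split by the recurrence for
  \<open>dist_poly\<close> and compared summand by summand. The shifts 0 and \<open>m\<close> are
  immediate, since both terms of the recurrence are summands of
  \<open>dist_poly (Suc m)\<close>.\<close>

lemma X_power_dist_poly_le: "j \<le> m \<Longrightarrow> X ^ j * dist_poly m \<preceq> dist_poly (Suc m)"
proof (induction m arbitrary: j)
  case 0
  then show ?case by simp
next
  case (Suc m)
  consider "j = 0" | "j = Suc m" | i where "j = Suc i" "i < m"
    using Suc.prems by (cases j) (auto simp: le_less)
  then show ?case
  proof cases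
    case 1
    then show ?thesis by (simp add: dist_poly_le_dist_poly_Suc)
  next
    case 2
    then show ?thesis by (simp add: dist_poly_Suc[of "Suc m"])
  next
    case 3
    \<comment> \<open>The second summand has shift \<open>j + m = Suc m + i\<close>, so the
      induction hypothesis applies with shift \<open>j\<close> to the first summand and with shift
      \<open>i\<close> to the second.\<close>
    have "X ^ j * dist_poly (Suc m) = X ^ j * dist_poly m + X ^ Suc m * (X ^ i * dist_poly m)"
      using 3 dist_poly_Suc[of m] by (simp add: algebra_simps)
    also have "\<dots> \<preceq> dist_poly (Suc m) + X ^ Suc m * dist_poly (Suc m)"
      using 3 by (intro coeff_le_add_mono coeff_le_mult_left Suc.IH) auto
    also have "\<dots> = dist_poly (Suc (Suc m))" by (simp add: dist_poly_Suc[of "Suc m"])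
    finally show ?thesis .
  qed
qed

text \<open>Splitting \<open>dist_poly (Suc m - b)\<close> produces the extra factor
  \<open>X ^ (m - b)\<close>. Together with \<open>X ^ b\<close> it becomes \<open>X ^ m\<close>,
  which no longer depends on \<open>b\<close> and can be pulled out of the sum.\<close>

lemma split_poly_Suc: "split_poly (Suc m) = split_poly m + X ^ m * conv_poly m"
proof -
  have step: "X ^ b * dist_poly (Suc m - b) * dist_poly b = X ^ b * dist_poly (m - b) * dist_poly b + X ^ m * (dist_poly (m - b) * dist_poly b)"
    if "b < m" for b
  proof -
    have "Suc m - b = Suc (m - b)" "X ^ m = X ^ b * X ^ (m - b)"
      using that by (simp_all flip: power_add)
    then show ?thesis using that by (simp only: dist_poly_Suc zero_less_diff) (simp add: algebra_simps)
  qed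
  \<comment> \<open>The new index \<open>b = m\<close> carries \<open>dist_poly 1\<close>, which
    equals \<open>dist_poly 0\<close>; it therefore supplies the last term of
    \<open>conv_poly m\<close>.\<close>
  have "split_poly (Suc m) = (\<Sum>b<m. X ^ b * dist_poly (Suc m - b) * dist_poly b) + X ^ m * dist_poly m"
    by (simp add: split_poly_def)
  also have "(\<Sum>b<m. X ^ b * dist_poly (Suc m - b) * dist_poly b) = split_poly m + X ^ m * (\<Sum>b<m. dist_poly (m - b) * dist_poly b)"
    by (simp add: step sum.distrib sum_distrib_left split_poly_def)
  also have "\<dots> + X ^ m * dist_poly m = split_poly m + X ^ m * conv_poly m"
    by (simp add: conv_poly_def distrib_left add.assoc flip: lessThan_Suc_atMost)
  finally show ?thesis .
qed

text \<open>Term \<open>b\<close> is sent to term \<open>b + 1\<close>: the factor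
  \<open>X ^ b\<close> is absorbed in passing from \<open>dist_poly b\<close> to
  \<open>dist_poly (Suc b)\<close>, and the other factor is unchanged.\<close>

lemma split_poly_le_conv_poly: "split_poly m \<preceq> conv_poly (Suc m)"
  unfolding split_poly_def conv_poly_def
proof (rule coeff_le_sum_reindex[of _ Suc])
  fix b
  show "X ^ b * dist_poly (m - b) * dist_poly b \<preceq> dist_poly (Suc m - Suc b) * dist_poly (Suc b)"
    using coeff_le_mult_left[OF X_power_dist_poly_le[of b b], of "dist_poly (m - b)"] by (simp add: mult_ac)
qed auto

text \<open>Sending term \<open>b\<close> to term \<open>b + 1\<close> absorbs one factor
  \<open>X\<close> in the weight. The other \<open>j - 1 \<le> l\<close> factors are shared between
  the two distinct-part polynomials, which can absorb \<open>l - b\<close> and \<open>b\<close> of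
  them.\<close>

lemma X_power_split_poly_le:
  assumes "j \<le> Suc l"
  shows "X ^ j * split_poly l \<preceq> split_poly (Suc (Suc l))"
proof (cases j)
  case 0
  then show ?thesis by (simp add: split_poly_Suc add.assoc)
next
  case (Suc i)
  show ?thesis
    unfolding split_poly_def sum_distrib_left
  proof (rule coeff_le_sum_reindex[of _ Suc])
    fix b assume b: "b \<in> {..<l}"
    \<comment> \<open>Greedy sharing: \<open>dist_poly b\<close> takes as many factors as it can,
      and at most \<open>l - b\<close> remain for the other polynomial.\<close>
    define i1 where "i1 = min i b"
    have i: "j = Suc ((i - i1) + i1)" "i1 \<le> b" "i - i1 \<le> l - b"
      using assms Suc b by (auto simp: i1_def min_def)
    have "X ^ j * (X ^ b * dist_poly (l - b) * dist_poly b)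
        = X ^ Suc b * ((X ^ (i - i1) * dist_poly (l - b)) * (X ^ i1 * dist_poly b))"
      unfolding i(1) by (simp only: power_add power_Suc mult_ac)
    also have "\<dots> \<preceq> X ^ Suc b * (dist_poly (Suc (l - b)) * dist_poly (Suc b))"
      by (intro coeff_le_mult_left coeff_le_mult_mono X_power_dist_poly_le i)
    also have "\<dots> = X ^ Suc b * dist_poly (Suc (Suc l) - Suc b) * dist_poly (Suc b)"
      using b by (simp add: mult.assoc Suc_diff_le)
    finally show "X ^ j * (X ^ b * dist_poly (l - b) * dist_poly b) \<preceq> \<dots>" .
  qed auto
qed

section \<open>Monotonicity of the inversion polynomials\<close>

text \<open>After unfolding both sides once, the parts with the maximum first compare by
  monotonicity at \<open>l - 1\<close>, the split parts by an index shift. Monotonicity is assumed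
  only below \<open>l\<close>, so the bound can be used inside an induction. For
  \<open>l = 0\<close> it would read \<open>X\<close> against 1 and fail.\<close>

lemma X_av_poly_le:
  assumes "\<And>i. Suc i \<le> l \<Longrightarrow> av_poly i \<preceq> av_poly (Suc i)" "l > 0"
  shows "X * av_poly l \<preceq> av_poly (Suc l)"
proof -
  obtain k where k: "l = Suc k" using \<open>l > 0\<close> by (cases l) auto
  have "X * split_poly k \<preceq> split_poly (Suc k)"
    unfolding split_poly_def sum_distrib_left
  proof (rule coeff_le_sum_reindex[of _ Suc])
    fix b
    show "X * (X ^ b * dist_poly (k - b) * dist_poly b) \<preceq> X ^ Suc b * dist_poly (Suc k - Suc b) * dist_poly (Suc b)"
      using coeff_le_mult_left[OF dist_poly_le_dist_poly_Suc[of b], of "X ^ Suc b * dist_poly (k - b)"]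
      by (simp add: mult_ac)
  qed auto
  moreover have "X ^ Suc k * av_poly k \<preceq> X ^ Suc k * av_poly (Suc k)"
    using assms k by (intro coeff_le_mult_left) auto
  ultimately have "X ^ Suc k * av_poly k + X * split_poly k \<preceq> X ^ Suc k * av_poly (Suc k) + split_poly (Suc k)"
    by (rule coeff_le_add_mono[rotated])
  then show ?thesis by (simp add: k algebra_simps)
qed

text \<open>Induction on \<open>l\<close>, taking two factors \<open>X\<close> out of the shift at
  each step. Shifts 0 and 1 are too small for this and follow from monotonicity and the previous
  bound.\<close>

lemma X_power_av_poly_le:
  assumes "\<And>i. i \<le> Suc l \<Longrightarrow> av_poly i \<preceq> av_poly (Suc i)" "j \<le> l"
  shows "X ^ j * av_poly l \<preceq> av_poly (Suc (Suc l))"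
  using assms
proof (induction l arbitrary: j)
  case 0
  then show ?case using coeff_le_trans[of "av_poly 0" "av_poly 1" "av_poly 2"] 
    by (simp add: numeral_2_eq_2 del: av_poly.simps)
next
  case (Suc l)
  have step: "av_poly (Suc (Suc l)) \<preceq> av_poly (Suc (Suc (Suc l)))" "av_poly (Suc l) \<preceq> av_poly (Suc (Suc l))" using Suc.prems(1)[of "Suc (Suc l)"] Suc.prems(1)[of "Suc l"]
    by (simp_all del: av_poly.simps)
  consider "j = 0" | "j = 1" | i where "j = Suc (Suc i)"
    by (metis One_nat_def not0_implies_Suc)
  then show ?case
  proof cases
    case 1
    then show ?thesis using coeff_le_trans[OF step(2,1)] by (simp del: av_poly.simps)
  next
    case 2
    have "X * av_poly (Suc l) \<preceq> av_poly (Suc (Suc l))"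
      using Suc.prems by (intro X_av_poly_le) auto
    with 2 show ?thesis using coeff_le_trans[OF _ step(1)] by (simp del: av_poly.simps)
  next
    case 3
    \<comment> \<open>Since \<open>j + l = Suc (Suc l) + i\<close>, the first summand has exactly
      the weight of the leading term of \<open>av_poly (Suc (Suc (Suc l)))\<close>.\<close>
    have "X ^ j * av_poly (Suc l) = X ^ Suc (Suc l) * (X ^ i * av_poly l) + X ^ j * split_poly l"
      by (simp add: 3 algebra_simps)
    also have "\<dots> \<preceq> X ^ Suc (Suc l) * av_poly (Suc (Suc l)) + split_poly (Suc (Suc l))"
      using Suc.prems 3 by (intro coeff_le_add_mono coeff_le_mult_left Suc.IH X_power_split_poly_le) auto
    also have "\<dots> = av_poly (Suc (Suc (Suc l)))" by (simp only: av_poly.simps)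
    finally show ?thesis .
  qed
qed

text \<open>The induction is strong because the shifted bounds need monotonicity at all smaller
  lengths.\<close>

lemma av_poly_mono: "av_poly n \<preceq> av_poly (Suc n)"
proof (induction n rule: less_induct)
  case (less n)
  show ?case
  proof (cases n)
    case 0
    then show ?thesis by (simp add: split_poly_def)
  next
    case (Suc m)
    \<comment> \<open>Multiplied by \<open>X ^ m\<close> and increased by
      \<open>split_poly m\<close>, this is the claim: \<open>X ^ m * conv_poly m\<close> completes
      \<open>split_poly m\<close> to \<open>split_poly (Suc m)\<close>, and the rest is the leading
      term of \<open>av_poly (Suc n)\<close>.\<close>
    have "av_poly m \<preceq> conv_poly m + X * av_poly (Suc m)"
    proof (cases m)
      case 0
      then show ?thesis by (simp add: conv_poly_def)
    next
      case (Suc k)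
      show ?thesis
      proof (cases k)
        case 0
        have "av_poly m = 1" "conv_poly m = 1 + 1" by (simp_all add: Suc 0 split_poly_def conv_poly_def)
        then show ?thesis by (simp add: add.assoc del: one_add_one)
      next
        case (Suc i)
        \<comment> \<open>One factor \<open>X\<close> is set aside so that the remaining shift
          \<open>i\<close> is within the range allowed by the shifted bound and
          \<open>X * av_poly (Suc m)\<close> appears.\<close>
        have "X ^ k * av_poly k = X * (X ^ i * av_poly k)" by (simp add: Suc mult_ac)
        also have "\<dots> \<preceq> X * av_poly (Suc (Suc k))"
          using Suc \<open>m = Suc k\<close> \<open>n = Suc m\<close>
          by (intro coeff_le_mult_left X_power_av_poly_le less.IH) auto
        finally have "split_poly k + X ^ k * av_poly k \<preceq> conv_poly m + X * av_poly (Suc m)"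
          using split_poly_le_conv_poly[of k] \<open>m = Suc k\<close> by (intro coeff_le_add_mono) (simp_all del: av_poly.simps)
        then show ?thesis by (simp add: \<open>m = Suc k\<close> add.commute)
      qed
    qed
    have "av_poly n = X ^ m * av_poly m + split_poly m" by (simp add: Suc)
    also have "\<dots> \<preceq> X ^ m * (conv_poly m + X * av_poly (Suc m)) + split_poly m"
      using \<open>av_poly m \<preceq> _\<close> by (intro coeff_le_add_mono coeff_le_mult_left) auto
    also have "\<dots> = av_poly (Suc n)"
      unfolding Suc av_poly.simps(2)[of "Suc m"] split_poly_Suc by (simp add: distrib_left mult_ac add_ac)
    finally show ?thesis .
  qed
qed

section \<open>Inversion generating functions\<close>

definition gf :: "nat list set \<Rightarrow> nat poly" where
  "gf A = (\<Sum>\<pi>\<in>A. X ^ card (inversions \<pi>))"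

lemma coeff_gf:
  assumes "finite A"
  shows "coeff (gf A) k = card {\<pi> \<in> A. card (inversions \<pi>) = k}"
proof -
  have "coeff (X ^ m) k = (if m = k then 1 else 0)" for m
    using monom_altdef[of "1::nat" m] by (simp add: X_def flip: coeff_monom)
  then show ?thesis
    using assms by (simp add: gf_def coeff_sum sum.If_cases Int_def)
qed

lemma gf_Un: "finite A \<Longrightarrow> finite B \<Longrightarrow> A \<inter> B = {} \<Longrightarrow> gf (A \<union> B) = gf A + gf B"
  by (simp add: gf_def sum.union_disjoint)

lemma gf_image:
  assumes "inj_on f A" "\<And>\<pi>. \<pi> \<in> A \<Longrightarrow> card (inversions (f \<pi>)) = c + card (inversions \<pi>)"
  shows "gf (f ` A) = X ^ c * gf A"
  using assms by (simp add: gf_def sum.reindex sum_distrib_left power_add)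

lemma gf_image2:
  assumes "inj_on f (A \<times> B)"
    and "\<And>\<sigma> \<tau>. \<sigma> \<in> A \<Longrightarrow> \<tau> \<in> B \<Longrightarrow>
      card (inversions (f (\<sigma>, \<tau>))) = c + card (inversions \<sigma>) + card (inversions \<tau>)"
  shows "gf (f ` (A \<times> B)) = X ^ c * gf A * gf B"
proof -
  have "gf (f ` (A \<times> B)) = (\<Sum>(\<sigma>, \<tau>)\<in>A \<times> B. X ^ c * (X ^ card (inversions \<sigma>) * X ^ card (inversions \<tau>)))"
    unfolding gf_def sum.reindex[OF assms(1)]
    by (intro sum.cong) (auto simp: assms(2) power_add mult.assoc)
  also have "\<dots> = X ^ c * (\<Sum>\<sigma>\<in>A. \<Sum>\<tau>\<in>B. X ^ card (inversions \<sigma>) * X ^ card (inversions \<tau>))"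
    by (simp add: sum_distrib_left sum.cartesian_product split_def)
  finally show ?thesis
    by (simp add: gf_def sum_product mult.assoc)
qed

section \<open>Inversions of composed lists\<close>

lemma finite_inversions: "finite (inversions xs)"
  by (rule finite_subset[of _ "{..<length xs} \<times> {..<length xs}"]) (auto simp: inversions_def)

lemma inversions_Nil [simp]: "inversions [] = {}"
  by (simp add: inversions_def)

text \<open>Inversions starting at position 0 correspond to later entries below \<open>x\<close>;
  all others are inversions of \<open>xs\<close> with both positions shifted by one.\<close>

lemma card_inversions_Cons:
  "card (inversions (x # xs)) = length (filter (\<lambda>y. y < x) xs) + card (inversions xs)"
proof -
  let ?f = "\<lambda>j::nat. (0::nat, Suc j)" and ?g = "\<lambda>(i, j). (Suc i, Suc j)"
  have "inversions (x # xs) = ?f ` {j. j < length xs \<and> xs ! j < x} \<union> ?g ` inversions xs"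
    (is "?L = ?R")
  proof (intro set_eqI iffI)
    fix p assume "p \<in> ?L"
    then obtain i j where p: "p = (i, Suc j)" and *: "i < Suc j" "j < length xs" "(x # xs) ! i > xs ! j"
      by (auto simp: inversions_def gr0_conv_Suc elim!: less_natE)
    show "p \<in> ?R"
    proof (cases i)
      case 0
      with p * show ?thesis by auto
    next
      case (Suc i')
      with p * have "p = ?g (i', j)" "(i', j) \<in> inversions xs"
        by (auto simp: inversions_def)
      then show ?thesis by blast
    qed
  qed (auto simp: inversions_def)
  moreover have "card (?f ` {j. j < length xs \<and> xs ! j < x}) = length (filter (\<lambda>y. y < x) xs)"
    by (simp add: card_image inj_on_def length_filter_conv_card)
  moreover have "card (?g ` inversions xs) = card (inversions xs)"
    by (intro card_image) (auto simp: inj_on_def)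
  moreover have "?f ` {j. j < length xs \<and> xs ! j < x} \<inter> ?g ` inversions xs = {}"
    by auto
  ultimately show ?thesis
    by (simp add: card_Un_disjoint finite_inversions)
qed

lemma card_inversions_append:
  "card (inversions (xs @ ys)) = card (inversions xs) + card (inversions ys)
     + (\<Sum>x\<leftarrow>xs. length (filter (\<lambda>y. y < x) ys))"
  by (induction xs) (auto simp: card_inversions_Cons)

lemma card_inversions_Cons_max:
  "(\<And>y. y \<in> set xs \<Longrightarrow> y < M) \<Longrightarrow> card (inversions (M # xs)) = length xs + card (inversions xs)"
  by (simp add: card_inversions_Cons filter_id_conv)

lemma card_inversions_Cons_min:
  "(\<And>y. y \<in> set xs \<Longrightarrow> m < y) \<Longrightarrow> card (inversions (m # xs)) = card (inversions xs)"
  by (auto simp: card_inversions_Cons filter_empty_conv dest: less_asym)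

lemma card_inversions_append_less:
  assumes "\<And>x y. x \<in> set xs \<Longrightarrow> y \<in> set ys \<Longrightarrow> x < y"
  shows "card (inversions (xs @ ys)) = card (inversions xs) + card (inversions ys)"
proof -
  have "(\<Sum>x\<leftarrow>xs. length (filter (\<lambda>y. y < x) ys)) = 0"
    using assms by (force simp: filter_empty_conv dest: less_asym)
  then show ?thesis by (simp add: card_inversions_append)
qed

lemma card_inversions_snoc_max:
  "(\<And>y. y \<in> set xs \<Longrightarrow> y < M) \<Longrightarrow> card (inversions (xs @ [M])) = card (inversions xs)"
  by (subst card_inversions_append_less) (auto simp: card_inversions_Cons)

section \<open>Pattern avoidance and the position of the maximum\<close>

text \<open>An occurrence of a three-letter pattern is a triple of entries, and a chain of two
  strict inequalities fixes its relative order completely.\<close>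

lemma contains_pattern_231: "contains_pattern \<pi> [2, 3, 1] \<longleftrightarrow> (\<exists>x y z. subseq [x, y, z] \<pi> \<and> z < x \<and> x < y)"
  and contains_pattern_132: "contains_pattern \<pi> [1, 3, 2] \<longleftrightarrow> (\<exists>x y z. subseq [x, y, z] \<pi> \<and> x < z \<and> z < y)"
  and contains_pattern_213: "contains_pattern \<pi> [2, 1, 3] \<longleftrightarrow> (\<exists>x y z. subseq [x, y, z] \<pi> \<and> y < x \<and> x < z)"
proof -
  have *: "contains_pattern \<pi> [a, b, c] \<longleftrightarrow>
      (\<exists>x y z. subseq [x, y, z] \<pi> \<and> order_isomorphic [x, y, z] [a, b, c])" for a b c
  proof
    assume "contains_pattern \<pi> [a, b, c]"
    then obtain s where s: "subseq s \<pi>" "order_isomorphic s [a, b, c]"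
      by (auto simp: contains_pattern_def)
    then have "length s = Suc (Suc (Suc 0))" by (simp add: order_isomorphic_def)
    with s show "\<exists>x y z. subseq [x, y, z] \<pi> \<and> order_isomorphic [x, y, z] [a, b, c]"
      by (auto simp: length_Suc_conv)
  qed (auto simp: contains_pattern_def)
  show "contains_pattern \<pi> [2, 3, 1] \<longleftrightarrow> (\<exists>x y z. subseq [x, y, z] \<pi> \<and> z < x \<and> x < y)"
    "contains_pattern \<pi> [1, 3, 2] \<longleftrightarrow> (\<exists>x y z. subseq [x, y, z] \<pi> \<and> x < z \<and> z < y)"
    "contains_pattern \<pi> [2, 1, 3] \<longleftrightarrow> (\<exists>x y z. subseq [x, y, z] \<pi> \<and> y < x \<and> x < z)"
    unfolding * by (intro ex_cong1 conj_cong refl; auto simp: order_isomorphic_def All_less_Suc)+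
qed

lemma contains_pattern_1324: "contains_pattern \<pi> [1, 3, 2, 4] \<longleftrightarrow>
    (\<exists>w x y z. subseq [w, x, y, z] \<pi> \<and> w < y \<and> y < x \<and> x < z)"
proof
  assume "contains_pattern \<pi> [1, 3, 2, 4]"
  then obtain s where s: "subseq s \<pi>" "order_isomorphic s [1, 3, 2, 4]"
    by (auto simp: contains_pattern_def)
  then have "length s = Suc (Suc (Suc (Suc 0)))" by (simp add: order_isomorphic_def)
  then obtain w x y z where "s = [w, x, y, z]" by (auto simp: length_Suc_conv)
  with s show "\<exists>w x y z. subseq [w, x, y, z] \<pi> \<and> w < y \<and> y < x \<and> x < z"
    by (intro exI[of _ w] exI[of _ x] exI[of _ y] exI[of _ z]) (auto simp: order_isomorphic_def All_less_Suc)
next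
  assume "\<exists>w x y z. subseq [w, x, y, z] \<pi> \<and> w < y \<and> y < x \<and> x < z"
  then obtain w x y z where "subseq [w, x, y, z] \<pi>" "w < y" "y < x" "x < z" by blast
  then show "contains_pattern \<pi> [1, 3, 2, 4]"
    unfolding contains_pattern_def
    by (intro exI[of _ "[w, x, y, z]"]) (auto simp: order_isomorphic_def All_less_Suc)
qed

lemma contains_pattern_subseq:
  "contains_pattern \<sigma> p \<Longrightarrow> subseq \<sigma> \<pi> \<Longrightarrow> contains_pattern \<pi> p"
  unfolding contains_pattern_def using subseq_order.order_trans by blast

lemma subseq_set: "subseq xs ys \<Longrightarrow> set xs \<subseteq> set ys"
  by (auto dest: list_emb_set)

text \<open>
  Permutations of an arbitrary interval of values, so that the parts on either side of the maximum
  need not be standardized.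
\<close>

definition Av :: "nat list set \<Rightarrow> nat \<Rightarrow> nat \<Rightarrow> nat list set" where
  "Av B l n = {\<pi> \<in> permutations_of_set {l..<l + n}. \<forall>p\<in>B. \<not> contains_pattern \<pi> p}"

lemma in_Av_iff: "\<pi> \<in> Av B l n \<longleftrightarrow>
    set \<pi> = {l..<l + n} \<and> distinct \<pi> \<and> (\<forall>p\<in>B. \<not> contains_pattern \<pi> p)"
  by (auto simp: Av_def permutations_of_set_def)

lemma finite_Av [simp]: "finite (Av B l n)"
  by (simp add: Av_def)

lemma length_Av: "\<pi> \<in> Av B l n \<Longrightarrow> length \<pi> = n"
  using distinct_card[of \<pi>] by (simp add: in_Av_iff)

lemma Av_0: "[] \<notin> B \<Longrightarrow> Av B l 0 = {[]}"
  by (auto simp: in_Av_iff contains_pattern_def order_isomorphic_def dest!: list_emb_Nil2)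

definition Av_132_231 :: "nat \<Rightarrow> nat \<Rightarrow> nat list set" where "Av_132_231 = Av {[1, 3, 2], [2, 3, 1]}"

definition Av_213_231 :: "nat \<Rightarrow> nat \<Rightarrow> nat list set" where "Av_213_231 = Av {[2, 1, 3], [2, 3, 1]}"

definition Av_1324_231 :: "nat \<Rightarrow> nat \<Rightarrow> nat list set" where "Av_1324_231 = Av {[1, 3, 2, 4], [2, 3, 1]}"

(* The unfolded copies still apply after the simplifier has turned 1 into Suc 0. *)
lemmas contains_pattern_iffs =
  contains_pattern_132 contains_pattern_213 contains_pattern_231 contains_pattern_1324
  contains_pattern_132[unfolded One_nat_def] contains_pattern_213[unfolded One_nat_def]
  contains_pattern_231[unfolded One_nat_def] contains_pattern_1324[unfolded One_nat_def]

section \<open>Extending a list by an extreme entry\<close>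

lemma order_isomorphic_less_iff:
  "order_isomorphic xs ys \<Longrightarrow> i < length xs \<Longrightarrow> j < length xs \<Longrightarrow> xs ! i < xs ! j \<longleftrightarrow> ys ! i < ys ! j"
  by (simp add: order_isomorphic_def)

text \<open>A newly created occurrence must use the new first entry, and necessarily as its first
  letter.\<close>

lemma contains_pattern_Cons:
  assumes "contains_pattern (x # xs) p" "\<not> contains_pattern xs p"
  obtains s where "subseq s xs" "order_isomorphic (x # s) p"
proof -
  obtain s where s: "subseq s (x # xs)" "order_isomorphic s p"
    using assms(1) by (auto simp: contains_pattern_def)
  have "\<not> subseq s xs"
    using assms(2) s(2) by (auto simp: contains_pattern_def)
  with s(1) obtain s' where "s = x # s'" "subseq s' xs"
    by (cases s) (auto split: if_splits)
  with s(2) show thesis using that by simp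
qed

text \<open>A new occurrence would use \<open>M\<close> as the letter \<open>a\<close>; the larger
  letter \<open>b\<close> would then require an entry of \<open>xs\<close> above
  \<open>M\<close>.\<close>

lemma avoids_max_first:
  assumes "\<And>y. y \<in> set xs \<Longrightarrow> y < M" "\<not> contains_pattern xs (a # p)" "b \<in> set p" "a < b"
  shows "\<not> contains_pattern (M # xs) (a # p)"
proof
  assume "contains_pattern (M # xs) (a # p)"
  then obtain s where s: "subseq s xs" "order_isomorphic (M # s) (a # p)"
    using assms(2) by (rule contains_pattern_Cons)
  then have len: "length s = length p" by (simp add: order_isomorphic_def)
  obtain i where i: "i < length p" "p ! i = b" using assms(3) by (auto simp: in_set_conv_nth)
  have "M < s ! i"
    using order_isomorphic_less_iff[OF s(2), of 0 "Suc i"] i len assms(4) by simp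
  moreover have "s ! i \<in> set xs" using subseq_set[OF s(1)] i len by auto
  ultimately show False using assms(1) by (meson less_asym)
qed

lemma avoids_min_first:
  assumes "\<And>y. y \<in> set xs \<Longrightarrow> m < y" "\<not> contains_pattern xs (a # p)" "b \<in> set p" "b < a"
  shows "\<not> contains_pattern (m # xs) (a # p)"
proof
  assume "contains_pattern (m # xs) (a # p)"
  then obtain s where s: "subseq s xs" "order_isomorphic (m # s) (a # p)"
    using assms(2) by (rule contains_pattern_Cons)
  then have len: "length s = length p" by (simp add: order_isomorphic_def)
  obtain i where i: "i < length p" "p ! i = b" using assms(3) by (auto simp: in_set_conv_nth)
  have "s ! i < m"
    using order_isomorphic_less_iff[OF s(2), of "Suc i" 0] i len assms(4) by simp
  moreover have "s ! i \<in> set xs" using subseq_set[OF s(1)] i len by auto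
  ultimately show False using assms(1) by (meson less_asym)
qed

lemma avoids_max_last:
  assumes "\<And>y. y \<in> set xs \<Longrightarrow> y < M" "\<not> contains_pattern xs (p @ [a])" "b \<in> set p" "a < b"
  shows "\<not> contains_pattern (xs @ [M]) (p @ [a])"
proof
  assume "contains_pattern (xs @ [M]) (p @ [a])"
  then obtain t where t: "subseq t (xs @ [M])" "order_isomorphic t (p @ [a])"
    by (auto simp: contains_pattern_def)
  from t(1) obtain s v where sv: "t = s @ v" "subseq s xs" "subseq v [M]"
    by (rule subseq_appendE)
  \<comment> \<open>If \<open>M\<close> took no part, the occurrence would already lie in
    \<open>xs\<close>.\<close>
  have "v \<noteq> []" using sv t(2) assms(2) by (auto simp: contains_pattern_def)
  with sv(3) have "v = [M]"
    by (cases v) (auto split: if_splits dest: list_emb_Nil2)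
  with sv t have len: "length s = length p" by (simp add: order_isomorphic_def)
  obtain i where i: "i < length p" "p ! i = b" using assms(3) by (auto simp: in_set_conv_nth)
  have "M < s ! i"
    using order_isomorphic_less_iff[OF t(2), of "length p" i] i len assms(4) sv(1) \<open>v = [M]\<close>
    by (simp add: nth_append)
  moreover have "s ! i \<in> set xs" using subseq_set[OF sv(2)] i len by auto
  ultimately show False using assms(1) by (meson less_asym)
qed

section \<open>Recursive structure of the three classes\<close>

lemma split_at_max:
  assumes "set \<pi> = {l..<l + Suc n}" "distinct \<pi>"
  obtains \<sigma> \<tau> where "\<pi> = \<sigma> @ (l + n) # \<tau>" "set \<sigma> \<union> set \<tau> = {l..<l + n}" "set \<sigma> \<inter> set \<tau> = {}"
    "distinct \<sigma>" "distinct \<tau>" "l + n \<notin> set \<sigma>" "l + n \<notin> set \<tau>"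
proof -
  have "l + n \<in> set \<pi>" using assms by simp
  then obtain \<sigma> \<tau> where \<pi>: "\<pi> = \<sigma> @ (l + n) # \<tau>" by (meson split_list)
  have "set \<sigma> \<union> set \<tau> = set \<pi> - {l + n}" using assms(2) \<pi> by auto
  also have "\<dots> = {l..<l + n}" unfolding assms(1) by auto
  finally have un: "set \<sigma> \<union> set \<tau> = {l..<l + n}" .
  have "distinct (\<sigma> @ (l + n) # \<tau>)" using assms(2) \<pi> by simp
  then show thesis by (intro that[OF \<pi> un]) auto
qed

text \<open>Otherwise \<open>x\<close>, \<open>M\<close>, \<open>z\<close> would themselves form
  231.\<close>

lemma avoids_231_split:
  assumes "\<not> contains_pattern (\<sigma> @ M # \<tau>) [2, 3, 1]" "x \<in> set \<sigma>" "z \<in> set \<tau>" "x < M" "x \<noteq> z"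
  shows "x < z"
proof -
  have "subseq ([x] @ M # [z]) (\<sigma> @ M # \<tau>)"
    using assms(2,3) by (intro list_emb_append_mono) (simp_all add: subseq_singleton_left)
  with assms(1,4,5) show ?thesis
    unfolding contains_pattern_231 append_Cons append_Nil by (meson linorder_neqE_nat)
qed

text \<open>Entries \<open>x\<close> before and \<open>z\<close> after the maximum would form 132 or
  231 with it, so the maximum stands at an end. Conversely, neither pattern begins or ends with its
  largest letter, so adding a maximum at an end is harmless.\<close>

lemma Av_132_231_Suc: "Av_132_231 l (Suc n) = (#) (l + n) ` Av_132_231 l n \<union> (\<lambda>\<sigma>. \<sigma> @ [l + n]) ` Av_132_231 l n"
proof (intro set_eqI iffI)
  fix \<pi> assume \<pi>: "\<pi> \<in> Av_132_231 l (Suc n)"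
  then obtain \<sigma> \<tau> where st: "\<pi> = \<sigma> @ (l + n) # \<tau>" "set \<sigma> \<union> set \<tau> = {l..<l + n}" "set \<sigma> \<inter> set \<tau> = {}"
    "distinct \<sigma>" "distinct \<tau>" "l + n \<notin> set \<sigma>" "l + n \<notin> set \<tau>"
    using split_at_max[of \<pi> l n] by (auto simp: Av_132_231_def in_Av_iff)
  have av: "\<not> contains_pattern \<pi> [1, 3, 2]" "\<not> contains_pattern \<pi> [2, 3, 1]"
    using \<pi> by (auto simp: Av_132_231_def in_Av_iff)
  have False if x: "x \<in> set \<sigma>" and z: "z \<in> set \<tau>" for x z
  proof -
    have bounds: "x < l + n" "z < l + n" "x \<noteq> z" using x z st by auto
    have "x < z" using av(2) x z bounds st(1) by (auto intro: avoids_231_split)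
    moreover have "subseq ([x] @ (l + n) # [z]) (\<sigma> @ (l + n) # \<tau>)"
      using x z by (intro list_emb_append_mono) (simp_all add: subseq_singleton_left)
    ultimately show False
      using av(1) bounds(2) unfolding st(1) contains_pattern_132 append_Cons append_Nil by blast
  qed
  then have "\<sigma> = [] \<or> \<tau> = []" by (metis list.set_intros(1) neq_Nil_conv)
  moreover have "subseq (\<sigma> @ \<tau>) \<pi>"
    unfolding st(1) by (intro list_emb_append_mono list_emb_Cons) simp_all
  then have "\<sigma> @ \<tau> \<in> Av_132_231 l n"
    using av st(2-5) contains_pattern_subseq[of "\<sigma> @ \<tau>" _ \<pi>] by (auto simp: Av_132_231_def in_Av_iff)
  ultimately show "\<pi> \<in> (#) (l + n) ` Av_132_231 l n \<union> (\<lambda>\<sigma>. \<sigma> @ [l + n]) ` Av_132_231 l n"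
    using st(1) by auto
next
  fix \<pi> assume "\<pi> \<in> (#) (l + n) ` Av_132_231 l n \<union> (\<lambda>\<sigma>. \<sigma> @ [l + n]) ` Av_132_231 l n"
  then obtain \<sigma> where "\<sigma> \<in> Av_132_231 l n" "\<pi> = (l + n) # \<sigma> \<or> \<pi> = \<sigma> @ [l + n]" by auto
  then show "\<pi> \<in> Av_132_231 l (Suc n)"
    using avoids_max_first[of \<sigma> "l + n" 1 "[3, 2]" 3] avoids_max_first[of \<sigma> "l + n" 2 "[3, 1]" 3]
      avoids_max_last[of \<sigma> "l + n" "[1, 3]" 2 3] avoids_max_last[of \<sigma> "l + n" "[2, 3]" 1 2]
    by (auto simp: Av_132_231_def in_Av_iff)
qed

text \<open>A first entry strictly between the minimum and the maximum would be followed by both,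
  giving 213 or 231 according to their order. Removing the minimum moves the value interval to
  \<open>Suc l\<close>.\<close>

lemma Av_213_231_Suc: "Av_213_231 l (Suc n) = (#) (l + n) ` Av_213_231 l n \<union> (#) l ` Av_213_231 (Suc l) n"
proof (intro set_eqI iffI)
  fix \<pi> assume \<pi>: "\<pi> \<in> Av_213_231 l (Suc n)"
  then obtain x \<sigma> where x: "\<pi> = x # \<sigma>"
    by (cases \<pi>) (auto simp: Av_213_231_def in_Av_iff)
  have set: "set \<sigma> = {l..<l + Suc n} - {x}" "distinct \<sigma>" "x \<in> {l..<l + Suc n}"
    using \<pi> x by (auto simp: Av_213_231_def in_Av_iff)
  have av: "\<not> contains_pattern \<pi> [2, 1, 3]" "\<not> contains_pattern \<pi> [2, 3, 1]"
    using \<pi> by (auto simp: Av_213_231_def in_Av_iff)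
  have "x = l + n \<or> x = l"
  proof (rule ccontr)
    assume "\<not> (x = l + n \<or> x = l)"
    then have "l < x" "x < l + n" "l \<in> set \<sigma>" "l + n \<in> set \<sigma>" using set by auto
    obtain us vs where us: "\<sigma> = us @ l # vs"
      using \<open>l \<in> set \<sigma>\<close> by (meson split_list)
    have no: "\<not> subseq [l, l + n] \<sigma>" "\<not> subseq [l + n, l] \<sigma>"
      using av \<open>l < x\<close> \<open>x < l + n\<close> subseq_Cons2[of _ \<sigma> x]
      unfolding x contains_pattern_213 contains_pattern_231 by blast+
    have "l + n \<in> set us \<or> l + n \<in> set vs"
      using \<open>l + n \<in> set \<sigma>\<close> \<open>l < x\<close> \<open>x < l + n\<close> us by auto
    then show False
    proof
      assume "l + n \<in> set us"
      then have "subseq ([l + n] @ [l]) (us @ l # vs)"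
        by (intro list_emb_append_mono) (simp_all add: subseq_singleton_left)
      with no(2) us show False by simp
    next
      assume "l + n \<in> set vs"
      then have "subseq ([] @ [l, l + n]) (us @ l # vs)"
        by (intro list_emb_append_mono) (simp_all add: subseq_singleton_left)
      with no(1) us show False by simp
    qed
  qed
  moreover have "\<not> contains_pattern \<sigma> p" if "p \<in> {[2, 1, 3], [2, 3, 1]}" for p
    using av that contains_pattern_subseq[of \<sigma> p \<pi>] x by auto
  moreover have "set \<sigma> = {l..<l + n}" if "x = l + n" unfolding set(1) that by auto
  moreover have "set \<sigma> = {Suc l..<Suc l + n}" if "x = l" unfolding set(1) that by auto
  ultimately have "x = l + n \<and> \<sigma> \<in> Av_213_231 l n \<or> x = l \<and> \<sigma> \<in> Av_213_231 (Suc l) n"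
    using set(2) unfolding Av_213_231_def in_Av_iff by blast
  then show "\<pi> \<in> (#) (l + n) ` Av_213_231 l n \<union> (#) l ` Av_213_231 (Suc l) n"
    using x by blast
next
  fix \<pi> assume "\<pi> \<in> (#) (l + n) ` Av_213_231 l n \<union> (#) l ` Av_213_231 (Suc l) n"
  then consider \<sigma> where "\<sigma> \<in> Av_213_231 l n" "\<pi> = (l + n) # \<sigma>" | \<sigma> where "\<sigma> \<in> Av_213_231 (Suc l) n" "\<pi> = l # \<sigma>"
    by auto
  then show "\<pi> \<in> Av_213_231 l (Suc n)"
  proof cases
    case 1
    then have "set \<sigma> = {l..<l + n}" "distinct \<sigma>" by (simp_all add: Av_213_231_def in_Av_iff)
    then have "set \<pi> = {l..<l + Suc n}" "distinct \<pi>"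
      unfolding 1(2) by (simp_all add: atLeastLessThanSuc)
    then show ?thesis
      using 1 avoids_max_first[of \<sigma> "l + n" 2 "[1, 3]" 3] avoids_max_first[of \<sigma> "l + n" 2 "[3, 1]" 3]
      by (simp add: Av_213_231_def in_Av_iff)
  next
    case 2
    then have "set \<sigma> = {Suc l..<Suc l + n}" "distinct \<sigma>" by (simp_all add: Av_213_231_def in_Av_iff)
    then have "set \<pi> = {l..<l + Suc n}" "distinct \<pi>"
      unfolding 2(2) using ivl_disj_un_singleton(3)[of l "l + Suc n"] by (simp_all add: atLeastSucLessThan_greaterThanLessThan)
    then show ?thesis
      using 2 avoids_min_first[of \<sigma> l 2 "[1, 3]" 1] avoids_min_first[of \<sigma> l 2 "[3, 1]" 1]
      by (simp add: Av_213_231_def in_Av_iff)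
  qed
qed

text \<open>The cases follow how an occurrence is cut between \<open>\<sigma>\<close> and
  \<open>M # \<tau>\<close>. Three or more letters in \<open>\<sigma>\<close> give 132 there; three
  or more on the right give 213 in \<open>\<tau>\<close>, unless \<open>M\<close> plays the 3 and
  has no larger entry after it. An even cut puts the 3 below the 2.\<close>

lemma avoids_1324_max:
  assumes "\<And>x y. x \<in> set \<sigma> \<Longrightarrow> y \<in> set \<tau> \<Longrightarrow> x < y" "\<And>x. x \<in> set \<sigma> \<union> set \<tau> \<Longrightarrow> x < M"
    and "\<not> contains_pattern \<sigma> [1, 3, 2]" "\<not> contains_pattern \<tau> [2, 1, 3]"
  shows "\<not> contains_pattern (\<sigma> @ M # \<tau>) [1, 3, 2, 4]"
proof
  assume "contains_pattern (\<sigma> @ M # \<tau>) [1, 3, 2, 4]"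
  then obtain w x y z where *: "subseq [w, x, y, z] (\<sigma> @ M # \<tau>)" "w < y" "y < x" "x < z"
    by (auto simp: contains_pattern_iffs)
  from *(1) obtain us vs where uv: "[w, x, y, z] = us @ vs" "subseq us \<sigma>" "subseq vs (M # \<tau>)"
    by (rule subseq_appendE)
  have s: "set us \<subseteq> set \<sigma>" "set vs \<subseteq> insert M (set \<tau>)"
    using subseq_set[OF uv(2)] subseq_set[OF uv(3)] by simp_all
  have no132: "\<not> subseq [w, x, y] \<sigma>"
    using assms(3) *(2,3) unfolding contains_pattern_132 by blast
  have no213: "\<not> subseq [x, y, z] \<tau>"
    using assms(4) *(3,4) unfolding contains_pattern_213 by blast
  consider "us = []" "vs = [w, x, y, z]" | "us = [w]" "vs = [x, y, z]" | "us = [w, x]" "vs = [y, z]"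
    | "us = [w, x, y]" | "us = [w, x, y, z]"
    using uv(1) unfolding Cons_eq_append_conv by blast
  then show False
  proof cases
    case 1
    with uv(3) no213 subseq_Cons'[of w "[x, y, z]" \<tau>] show False
      by (auto split: if_splits)
  next
    case 2
    with uv(3) no213 have "x = M" "subseq [y, z] \<tau>"
      by (auto split: if_splits)
    with subseq_set[of "[y, z]" \<tau>] have "z < M" by (auto intro: assms(2))
    with \<open>x = M\<close> \<open>x < z\<close> show False by simp
  next
    case 3
    with s have "x \<in> set \<sigma>" "y \<in> insert M (set \<tau>)" by auto
    then have "x < y" using assms(1,2) by auto
    with \<open>y < x\<close> show False by simp
  next
    case 4
    with uv(2) no132 show False by simp
  next
    case 5
    with uv(2) no132 show False using subseq_order.order_trans[of "[w, x, y]" "[w, x, y, z]" \<sigma>] by simp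
  qed
qed

text \<open>An occurrence cannot lie in \<open>\<sigma>\<close> or in \<open>M # \<tau>\<close>
  alone, so its first letter is in \<open>\<sigma>\<close> and its last is not. The first is then
  the smaller of the two, contradicting 231.\<close>

lemma avoids_231_max:
  assumes "\<And>x y. x \<in> set \<sigma> \<Longrightarrow> y \<in> set \<tau> \<Longrightarrow> x < y" "\<And>x. x \<in> set \<sigma> \<union> set \<tau> \<Longrightarrow> x < M"
    and "\<not> contains_pattern \<sigma> [2, 3, 1]" "\<not> contains_pattern \<tau> [2, 3, 1]"
  shows "\<not> contains_pattern (\<sigma> @ M # \<tau>) [2, 3, 1]"
proof
  assume "contains_pattern (\<sigma> @ M # \<tau>) [2, 3, 1]"
  then obtain x y z where *: "subseq [x, y, z] (\<sigma> @ M # \<tau>)" "z < x" "x < y"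
    by (auto simp: contains_pattern_iffs)
  from *(1) obtain us vs where uv: "[x, y, z] = us @ vs" "subseq us \<sigma>" "subseq vs (M # \<tau>)"
    by (rule subseq_appendE)
  have "\<not> contains_pattern (M # \<tau>) [2, 3, 1]"
    using assms(2,4) by (intro avoids_max_first[where b = 3]) auto
  then have no: "\<not> subseq [x, y, z] \<sigma>" "\<not> subseq [x, y, z] (M # \<tau>)"
    using assms(3) * unfolding contains_pattern_iffs by blast+
  then have "x \<in> set us" "z \<in> set vs"
    using uv by (auto simp: Cons_eq_append_conv simp del: subseq_Cons2_iff)
  then have "x \<in> set \<sigma>" "z \<in> insert M (set \<tau>)"
    using subseq_set[OF uv(2)] subseq_set[OF uv(3)] by auto
  then have "x < z" using assms(1,2) by auto
  with \<open>z < x\<close> show False by simp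
qed

text \<open>The sorted parts concatenate to the increasing enumeration of the interval, which is
  then cut at \<open>length \<sigma>\<close>. Hence both parts are again permutations of
  intervals.\<close>

lemma initial_segment:
  assumes "set \<sigma> \<union> set \<tau> = {l..<l + n}" "distinct \<sigma>" "distinct \<tau>"
    and less: "\<And>x y. x \<in> set \<sigma> \<Longrightarrow> y \<in> set \<tau> \<Longrightarrow> x < y"
  shows "set \<sigma> = {l..<l + length \<sigma>}" "set \<tau> = {l + length \<sigma>..<l + n}" "length \<sigma> + length \<tau> = n"
proof -
  have disj: "set \<sigma> \<inter> set \<tau> = {}" using less by fastforce
  have eq: "sort \<sigma> @ sort \<tau> = [l..<l + n]"
    using assms disj
    by (intro sorted_distinct_set_unique) (auto simp: sorted_append intro: less_imp_le)
  from arg_cong[OF eq, of length] show len: "length \<sigma> + length \<tau> = n" by simp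
  have "sort \<sigma> = take (length \<sigma>) [l..<l + n]" "sort \<tau> = drop (length \<sigma>) [l..<l + n]"
    by (simp_all flip: eq)
  then have "sort \<sigma> = [l..<l + length \<sigma>]" "sort \<tau> = [l + length \<sigma>..<l + n]"
    using len by (simp_all add: take_upt drop_upt)
  then show "set \<sigma> = {l..<l + length \<sigma>}" "set \<tau> = {l + length \<sigma>..<l + n}"
    by (metis set_sort set_upt)+
qed

text \<open>With \<open>b = length \<tau>\<close>, the range \<open>b < n\<close> says that
  \<open>\<sigma>\<close> is nonempty. The case of empty \<open>\<sigma>\<close> is the first image,
  where a leading maximum imposes nothing on the rest.\<close>

lemma Av_1324_231_Suc: "Av_1324_231 l (Suc n) = (#) (l + n) ` Av_1324_231 l n \<union>
    (\<Union>b<n. (\<lambda>(\<sigma>, \<tau>). \<sigma> @ (l + n) # \<tau>) ` (Av_132_231 l (n - b) \<times> Av_213_231 (l + (n - b)) b))"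
  (is "_ = ?L \<union> ?R")
proof (intro set_eqI iffI)
  fix \<pi> assume \<pi>: "\<pi> \<in> Av_1324_231 l (Suc n)"
  then obtain \<sigma> \<tau> where st: "\<pi> = \<sigma> @ (l + n) # \<tau>" "set \<sigma> \<union> set \<tau> = {l..<l + n}" "set \<sigma> \<inter> set \<tau> = {}"
    "distinct \<sigma>" "distinct \<tau>" "l + n \<notin> set \<sigma>" "l + n \<notin> set \<tau>"
    using split_at_max[of \<pi> l n] by (auto simp: Av_1324_231_def in_Av_iff)
  have av: "\<not> contains_pattern \<pi> [1, 3, 2, 4]" "\<not> contains_pattern \<pi> [2, 3, 1]"
    using \<pi> by (auto simp: Av_1324_231_def in_Av_iff)
  have bound: "x < l + n" if "x \<in> set \<sigma> \<union> set \<tau>" for x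
    using that unfolding st(2) by simp
  have less: "x < z" if "x \<in> set \<sigma>" "z \<in> set \<tau>" for x z
  proof (rule avoids_231_split)
    show "\<not> contains_pattern (\<sigma> @ (l + n) # \<tau>) [2, 3, 1]" using av(2) st(1) by simp
    show "x < l + n" using that bound by blast
    show "x \<noteq> z" using that st(3) by blast
  qed (use that in auto)
  have av_sub: "\<not> contains_pattern \<sigma> [2, 3, 1]" "\<not> contains_pattern \<tau> [2, 3, 1]"
    "\<not> contains_pattern \<tau> [1, 3, 2, 4]"
    using av st(1) contains_pattern_subseq[of _ _ \<pi>] by auto
  show "\<pi> \<in> ?L \<union> ?R"
  proof (cases "\<sigma> = []")
    case True
    with av_sub st show ?thesis by (auto simp: Av_1324_231_def in_Av_iff)
  next
    case False
    note seg = initial_segment[OF st(2,4,5) less]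
    have "\<not> contains_pattern \<sigma> [1, 3, 2]"
    proof
      assume "contains_pattern \<sigma> [1, 3, 2]"
      then obtain x y z where *: "subseq [x, y, z] \<sigma>" "x < z" "z < y"
        unfolding contains_pattern_132 by blast
      have "y < l + n" using bound subseq_set[OF *(1)] by simp
      \<comment> \<open>The maximum acts as the 4 and turns 132 into 1324.\<close>
      moreover have "subseq ([x, y, z] @ [l + n]) \<pi>"
        unfolding st(1) using * by (intro list_emb_append_mono) auto
      ultimately show False
        using av(1) *(2,3) unfolding contains_pattern_1324 append_Cons append_Nil by blast
    qed
    moreover have "\<not> contains_pattern \<tau> [2, 1, 3]"
    proof
      assume "contains_pattern \<tau> [2, 1, 3]"
      then obtain x y z where *: "subseq [x, y, z] \<tau>" "y < x" "x < z"
        unfolding contains_pattern_213 by blast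
      obtain w where w: "w \<in> set \<sigma>" using False by (cases \<sigma>) auto
      have "w < y" using less[OF w] subseq_set[OF *(1)] by simp
      \<comment> \<open>Any entry of \<open>\<sigma>\<close> lies below \<open>\<tau>\<close> and
        acts as the 1, turning 213 into 1324.\<close>
      moreover have "subseq ([w] @ [x, y, z]) \<pi>"
        unfolding st(1) using *(1) w
        by (intro list_emb_append_mono list_emb_Cons) (simp_all add: subseq_singleton_left)
      ultimately show False
        using av(1) *(2,3) unfolding contains_pattern_1324 append_Cons append_Nil by blast
    qed
    moreover have eqs: "n - length \<tau> = length \<sigma>" "l + length \<sigma> + length \<tau> = l + n" "length \<tau> < n"
      using seg(3) False by auto
    ultimately have "\<sigma> \<in> Av_132_231 l (n - length \<tau>)" "\<tau> \<in> Av_213_231 (l + (n - length \<tau>)) (length \<tau>)"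
      using av_sub st(4,5) seg(1,2) unfolding Av_132_231_def Av_213_231_def in_Av_iff eqs(1,2) by blast+
    then have "\<pi> \<in> (\<lambda>(\<sigma>, \<tau>). \<sigma> @ (l + n) # \<tau>) `
        (Av_132_231 l (n - length \<tau>) \<times> Av_213_231 (l + (n - length \<tau>)) (length \<tau>))"
      unfolding st(1) by (intro image_eqI[of _ _ "(\<sigma>, \<tau>)"]) simp_all
    with eqs(3) show ?thesis by blast
  qed
next
  fix \<pi> assume "\<pi> \<in> ?L \<union> ?R"
  then consider \<sigma> where "\<sigma> \<in> Av_1324_231 l n" "\<pi> = (l + n) # \<sigma>"
    | b \<sigma> \<tau> where "b < n" "\<sigma> \<in> Av_132_231 l (n - b)" "\<tau> \<in> Av_213_231 (l + (n - b)) b" "\<pi> = \<sigma> @ (l + n) # \<tau>"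
    by auto
  then show "\<pi> \<in> Av_1324_231 l (Suc n)"
  proof cases
    case 1
    then have "set \<sigma> = {l..<l + n}" "distinct \<sigma>" by (simp_all add: Av_1324_231_def in_Av_iff)
    then have "set \<pi> = {l..<l + Suc n}" "distinct \<pi>"
      unfolding 1(2) by (simp_all add: atLeastLessThanSuc)
    then show ?thesis
      using 1 avoids_max_first[of \<sigma> "l + n" 1 "[3, 2, 4]" 3] avoids_max_first[of \<sigma> "l + n" 2 "[3, 1]" 3]
      by (simp add: Av_1324_231_def in_Av_iff)
  next
    case 2
    then have st: "set \<sigma> = {l..<l + (n - b)}" "distinct \<sigma>" "set \<tau> = {l + (n - b)..<l + n}" "distinct \<tau>"
      by (simp_all add: Av_132_231_def Av_213_231_def in_Av_iff)
    have less: "x < y" if "x \<in> set \<sigma>" "y \<in> set \<tau>" for x y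
      using that unfolding st by simp
    have bound: "x < l + n" if "x \<in> set \<sigma> \<union> set \<tau>" for x
      using that unfolding st by auto
    have av: "\<not> contains_pattern \<sigma> [1, 3, 2]" "\<not> contains_pattern \<sigma> [2, 3, 1]"
      "\<not> contains_pattern \<tau> [2, 1, 3]" "\<not> contains_pattern \<tau> [2, 3, 1]"
      using 2(2,3) by (simp_all add: Av_132_231_def Av_213_231_def in_Av_iff)
    have "set \<sigma> \<union> set \<tau> = {l..<l + n}"
      unfolding st by (rule ivl_disj_un_two) simp_all
    then have "set \<pi> = {l..<l + Suc n}"
      unfolding 2(4) by (simp add: atLeastLessThanSuc)
    moreover have "set \<sigma> \<inter> set \<tau> = {}" "l + n \<notin> set \<sigma>" "l + n \<notin> set \<tau>"
      using less bound by blast+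
    then have "distinct \<pi>"
      unfolding 2(4) using st(2,4) by simp
    moreover have "\<not> contains_pattern \<pi> [1, 3, 2, 4]" "\<not> contains_pattern \<pi> [2, 3, 1]"
      unfolding 2(4) using avoids_1324_max[OF less bound av(1,3)] avoids_231_max[OF less bound av(2,4)]
      by blast+
    ultimately show ?thesis
      by (simp add: Av_1324_231_def in_Av_iff)
  qed
qed

section \<open>Generating functions of the avoidance classes\<close>

text \<open>A leading maximum adds \<open>n\<close> inversions and a trailing one adds none, which
  gives the factor \<open>1 + X ^ n\<close>.\<close>

lemma gf_Av_132_231: "gf (Av_132_231 l n) = dist_poly n"
proof (induction n)
  case 0
  then show ?case by (simp add: Av_132_231_def Av_0 gf_def)
next
  case (Suc n)
  show ?case
  \<comment> \<open>For \<open>n = 0\<close> the two images coincide, and counting both would give 2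
    instead of 1.\<close>
  proof (cases "n = 0")
    case True
    have "Av_132_231 l (Suc 0) = {[l]}" by (subst Av_132_231_Suc) (simp add: Av_132_231_def Av_0)
    then show ?thesis using True by (simp add: gf_def card_inversions_Cons)
  next
    case False
    have bound: "y < l + n" if "\<sigma> \<in> Av_132_231 l n" "y \<in> set \<sigma>" for \<sigma> y
      using that by (auto simp: Av_132_231_def in_Av_iff)
    have len: "length \<sigma> = n" if "\<sigma> \<in> Av_132_231 l n" for \<sigma>
      using that by (simp add: Av_132_231_def length_Av)
    have "gf ((#) (l + n) ` Av_132_231 l n) = X ^ n * gf (Av_132_231 l n)"
      by (intro gf_image) (auto simp: card_inversions_Cons_max bound len)
    moreover have "gf ((\<lambda>\<sigma>. \<sigma> @ [l + n]) ` Av_132_231 l n) = X ^ 0 * gf (Av_132_231 l n)"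
      by (intro gf_image) (auto simp: inj_on_def card_inversions_snoc_max bound)
    moreover have "(#) (l + n) ` Av_132_231 l n \<inter> (\<lambda>\<sigma>. \<sigma> @ [l + n]) ` Av_132_231 l n = {}"
    proof -
      have "(l + n) # \<sigma> \<notin> Av_132_231 l n" for \<sigma> using bound[of "(l + n) # \<sigma>" "l + n"] by auto
      moreover have "[] \<notin> Av_132_231 l n" using len[of "[]"] False by auto
      ultimately show ?thesis by (auto simp: Cons_eq_append_conv)
    qed
    moreover have "finite (Av_132_231 l n)" by (simp add: Av_132_231_def)
    ultimately show ?thesis
      using Suc.IH False by (simp add: Av_132_231_Suc gf_Un dist_poly_Suc add.commute)
  qed
qed

text \<open>A leading maximum adds \<open>n\<close> inversions, a leading minimum none. The
  induction is over all \<open>l\<close>, since removing the minimum shifts the interval.\<close>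

lemma gf_Av_213_231: "gf (Av_213_231 l n) = dist_poly n"
proof (induction n arbitrary: l)
  case 0
  then show ?case by (simp add: Av_213_231_def Av_0 gf_def)
next
  case (Suc n)
  show ?case
  proof (cases "n = 0")
    case True
    have "Av_213_231 l (Suc 0) = {[l]}" by (subst Av_213_231_Suc) (simp add: Av_213_231_def Av_0)
    then show ?thesis using True by (simp add: gf_def card_inversions_Cons)
  next
    case False
    have bound: "i \<le> y" "y < i + n" if "\<sigma> \<in> Av_213_231 i n" "y \<in> set \<sigma>" for \<sigma> y i
      using that by (auto simp: Av_213_231_def in_Av_iff)
    have len: "length \<sigma> = n" if "\<sigma> \<in> Av_213_231 l n" for \<sigma>
      using that by (simp add: Av_213_231_def length_Av)
    have "gf ((#) (l + n) ` Av_213_231 l n) = X ^ n * gf (Av_213_231 l n)"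
      by (intro gf_image) (auto simp: card_inversions_Cons_max bound len)
    moreover have "gf ((#) l ` Av_213_231 (Suc l) n) = X ^ 0 * gf (Av_213_231 (Suc l) n)"
      by (intro gf_image) (auto simp: card_inversions_Cons_min Suc_le_lessD[OF bound(1)])
    moreover have "(#) (l + n) ` Av_213_231 l n \<inter> (#) l ` Av_213_231 (Suc l) n = {}"
      using False by auto
    moreover have "finite (Av_213_231 l n)" "finite (Av_213_231 (Suc l) n)" by (simp_all add: Av_213_231_def)
    ultimately show ?thesis
      using Suc.IH False by (simp add: Av_213_231_Suc gf_Un dist_poly_Suc add.commute)
  qed
qed

text \<open>When the list is cut at its maximum, the only inversions between different parts are
  those of the maximum with the \<open>b\<close> entries of \<open>\<tau>\<close>; this is the
  weight \<open>X ^ b\<close>.\<close>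

lemma gf_Av_1324_231: "gf (Av_1324_231 l n) = av_poly n"
proof (induction n)
  case 0
  then show ?case by (simp add: Av_1324_231_def Av_0 gf_def)
next
  case (Suc n)
  let ?f = "\<lambda>(\<sigma>, \<tau>). \<sigma> @ (l + n) # \<tau>"
  let ?P = "\<lambda>b. Av_132_231 l (n - b) \<times> Av_213_231 (l + (n - b)) b"
  have len: "length \<sigma> = k" if "\<sigma> \<in> Av_1324_231 i k \<or> \<sigma> \<in> Av_132_231 i k \<or> \<sigma> \<in> Av_213_231 i k" for \<sigma> i k
    using that by (auto simp: Av_132_231_def Av_213_231_def Av_1324_231_def length_Av)
  have bound: "x < i + k" if "\<sigma> \<in> Av_1324_231 i k \<or> \<sigma> \<in> Av_132_231 i k \<or> \<sigma> \<in> Av_213_231 i k" "x \<in> set \<sigma>" for \<sigma> i k x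
    using that by (auto simp: Av_132_231_def Av_213_231_def Av_1324_231_def in_Av_iff)
  have lower: "i \<le> x" if "\<sigma> \<in> Av_213_231 i k" "x \<in> set \<sigma>" for \<sigma> i k x
    using that by (auto simp: Av_213_231_def in_Av_iff)
  have fin: "finite (Av_1324_231 l n)" "finite (Av_132_231 l k)" "finite (Av_213_231 i k)" for k i
    by (simp_all add: Av_1324_231_def Av_132_231_def Av_213_231_def)
  \<comment> \<open>The value \<open>l + n\<close> occurs only once, so the cut is unique. This
    gives both injectivity for fixed \<open>b\<close> and disjointness for different
    \<open>b\<close>.\<close>
  have inj: "\<sigma> = \<sigma>' \<and> \<tau> = \<tau>'"
    if "\<sigma> \<in> Av_132_231 l (n - b)" "\<tau> \<in> Av_213_231 (l + (n - b)) b" "b < n" "\<sigma> @ (l + n) # \<tau> = \<sigma>' @ (l + n) # \<tau>'"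
    for b \<sigma> \<tau> \<sigma>' \<tau>'
  proof -
    have "l + n \<notin> set \<sigma>" "l + n \<notin> set \<tau>"
      using bound[of \<sigma> l "n - b" "l + n"] bound[of \<tau> "l + (n - b)" b "l + n"] that by auto
    with that(4) show ?thesis by (simp add: append_Cons_eq_iff)
  qed
  have 1: "gf ((#) (l + n) ` Av_1324_231 l n) = X ^ n * gf (Av_1324_231 l n)"
  proof (rule gf_image)
    fix \<pi> assume "\<pi> \<in> Av_1324_231 l n"
    then show "card (inversions ((l + n) # \<pi>)) = n + card (inversions \<pi>)"
      using bound[of \<pi> l n] len[of \<pi> l n] by (subst card_inversions_Cons_max) auto
  qed simp
  have 2: "gf (?f ` ?P b) = X ^ b * dist_poly (n - b) * dist_poly b" if "b < n" for b
  proof -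
    have "gf (?f ` ?P b) = X ^ b * gf (Av_132_231 l (n - b)) * gf (Av_213_231 (l + (n - b)) b)"
    proof (rule gf_image2)
      show "inj_on ?f (?P b)" using inj that by (fastforce simp: inj_on_def)
      fix \<sigma> \<tau> assume *: "\<sigma> \<in> Av_132_231 l (n - b)" "\<tau> \<in> Av_213_231 (l + (n - b)) b"
      have "card (inversions (\<sigma> @ (l + n) # \<tau>)) = card (inversions \<sigma>) + card (inversions ((l + n) # \<tau>))"
      proof (rule card_inversions_append_less)
        fix x y assume "x \<in> set \<sigma>" "y \<in> set ((l + n) # \<tau>)"
        with * show "x < y"
          using bound[of \<sigma> l "n - b" x] lower[of \<tau> "l + (n - b)" b y] by auto
      qed
      also have "card (inversions ((l + n) # \<tau>)) = b + card (inversions \<tau>)"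
        using *(2) that bound[of \<tau> "l + (n - b)" b] len[of \<tau> "l + (n - b)" b]
        by (subst card_inversions_Cons_max) auto
      finally show "card (inversions (?f (\<sigma>, \<tau>))) = b + card (inversions \<sigma>) + card (inversions \<tau>)"
        by simp
    qed
    then show ?thesis by (simp only: gf_Av_132_231 gf_Av_213_231)
  qed
  have "gf (\<Union>b<n. ?f ` ?P b) = (\<Sum>b<n. gf (?f ` ?P b))"
    unfolding gf_def
  proof (rule sum.UNION_disjoint)
    show "\<forall>b\<in>{..<n}. finite (?f ` ?P b)" by (auto simp: fin)
    show "\<forall>b\<in>{..<n}. \<forall>c\<in>{..<n}. b \<noteq> c \<longrightarrow> ?f ` ?P b \<inter> ?f ` ?P c = {}"
    proof (intro ballI impI equals0I)
      fix b c \<pi> assume bc: "b \<in> {..<n}" "c \<in> {..<n}" "b \<noteq> c" "\<pi> \<in> ?f ` ?P b \<inter> ?f ` ?P c"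
      then obtain \<sigma> \<tau> \<sigma>' \<tau>' where *: "\<sigma> \<in> Av_132_231 l (n - b)" "\<tau> \<in> Av_213_231 (l + (n - b)) b"
        "\<tau>' \<in> Av_213_231 (l + (n - c)) c" "\<sigma> @ (l + n) # \<tau> = \<sigma>' @ (l + n) # \<tau>'" by auto
      with bc(1) inj have "\<tau> = \<tau>'" by blast
      with * len[of \<tau>] bc(3) show False by metis
    qed
  qed auto
  also have "\<dots> = split_poly n" unfolding split_poly_def by (intro sum.cong refl 2) simp
  finally have 3: "gf (\<Union>b<n. ?f ` ?P b) = split_poly n" .
  \<comment> \<open>In the union the maximum is preceded by \<open>n - b > 0\<close> smaller
    entries, so it never stands first.\<close>
  have "(#) (l + n) ` Av_1324_231 l n \<inter> (\<Union>b<n. ?f ` ?P b) = {}"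
  proof -
    have False if "b < n" "\<sigma> \<in> Av_132_231 l (n - b)" "(l + n) # \<rho> = \<sigma> @ (l + n) # \<tau>" for b \<rho> \<sigma> \<tau>
    proof (cases \<sigma>)
      case Nil
      with len[of \<sigma> l "n - b"] that show False by simp
    next
      case (Cons x \<sigma>'')
      with bound[of \<sigma> l "n - b" x] that show False by simp
    qed
    then show ?thesis by fastforce
  qed
  moreover have "finite ((#) (l + n) ` Av_1324_231 l n)" "finite (\<Union>b<n. ?f ` ?P b)"
    by (auto simp: fin)
  ultimately show ?case
    unfolding Av_1324_231_Suc by (simp only: gf_Un 1 3 Suc.IH av_poly.simps)
qed

theorem theorem3p2:
  shows "inversion_monotone {[1, 3, 2, 4], [2, 3, 1]}"
proof -
  have "av n k {[1, 3, 2, 4], [2, 3, 1]} = coeff (av_poly n) k" for n k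
  proof -
    \<comment> \<open>Ordinary permutations are the case \<open>l = 1\<close> of the interval
      classes.\<close>
    have "{\<pi> \<in> permutations_of_set {1..n}. card (inversions \<pi>) = k \<and>
            (\<forall>p\<in>{[1, 3, 2, 4], [2, 3, 1]}. \<not> contains_pattern \<pi> p)}
        = {\<pi> \<in> Av_1324_231 1 n. card (inversions \<pi>) = k}"
      by (auto simp: Av_1324_231_def Av_def atLeastLessThanSuc_atLeastAtMost)
    then have "av n k {[1, 3, 2, 4], [2, 3, 1]} = card {\<pi> \<in> Av_1324_231 1 n. card (inversions \<pi>) = k}"
      by (simp only: av_def)
    also have "\<dots> = coeff (gf (Av_1324_231 1 n)) k"
      by (simp only: coeff_gf Av_1324_231_def finite_Av)
    finally show ?thesis by (simp only: gf_Av_1324_231)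
  qed
  then show ?thesis
    using coeff_leD[OF av_poly_mono] by (simp add: inversion_monotone_def del: av_poly.simps)
qed

end
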